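(* For each fixed $n\ge 1$, the sequence of polynomials $\left(i_{B_q}(n,k)\right)_{0\le k\le n^2}$ is strongly $q$-log-concave in $k$; that is, for all integers $0<l\le k$, the polynomial $$i_{B_q}(n,l)\, i_{B_q}(n,k)-i_{B_q}(n,l-1)\, i_{B_q}(n,k+1)$$ has nonnegative coefficients as a polynomial in $q$.
   Context: $B_n$ is the hyperoctahedral group: the group of bijections $\pi$ of $\{-n,\ldots,-1,1,\ldots,n\}$ with $\pi(-j)=-\pi(j)$ for all $j\in\{1,\dots,n\}$. Every $\pi\in B_n$ is written uniquely as $\pi(p)=(-1)^{r_p}\sigma_p$ for $1\le p\le n$, with $r_p\in\{0,1\}$ and $\sigma=\sigma_1\cdots\sigma_n$ a permutation of $\{1,\dots,n\}$. For $1\le i\le n$ put $m=n+1-i$ and $inv_i(\sigma)=|\{j: j<m,\ \sigma_j>\sigma_m\}|$, and define $inv_i(\pi)=inv_i(\sigma)$ if $r_m=0$, and $inv_i(\pi)=1+2|\{j: j<m,\ \sigma_j<\sigma_m\}|+inv_i(\sigma)$ if $r_m=1$. Put $inv_B(\pi)=\sum_{i=1}^n inv_i(\pi)$, $I_B(n,k)=\{\pi\in B_n: inv_B(\pi)=k\}$ and $\omega(\pi)=\sum_{i=1}^n(n-i+1)\,inv_i(\pi)$. With $q$ an indeterminate, the $q$-Mahonian number of type $B$ is $i_{B_q}(n,k)=\sum_{\pi\in I_B(n,k)}q^{\omega(\pi)}$, with $i_{B_q}(n,k)=0$ unless $0\le k\le n^2$. *)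

theory Defs
  imports "HOL-Combinatorics.Permutations" "HOL-Computational_Algebra.Polynomial"
begin

(* The bijections of {-n,...,-1,1,...,n} are represented as functions on all integers that are the
   identity outside this set, so that each group element is a single function. *)
definition hyperoctahedral :: "nat \<Rightarrow> (int \<Rightarrow> int) set" where
  "hyperoctahedral n =
     {\<pi>. \<pi> permutes ({- int n..int n} - {0}) \<and> (\<forall>j\<in>{1..int n}. \<pi> (- j) = - \<pi> j)}"

definition sign_exp :: "(int \<Rightarrow> int) \<Rightarrow> nat \<Rightarrow> nat" where
  "sign_exp \<pi> p = (if \<pi> (int p) < 0 then 1 else 0)"

definition underlying_perm :: "(int \<Rightarrow> int) \<Rightarrow> nat \<Rightarrow> nat" where
  "underlying_perm \<pi> p = nat \<bar>\<pi> (int p)\<bar>"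

definition inv_perm :: "nat \<Rightarrow> (nat \<Rightarrow> nat) \<Rightarrow> nat \<Rightarrow> nat" where
  "inv_perm n \<sigma> i = (let m = n + 1 - i in card {j \<in> {1..<m}. \<sigma> j > \<sigma> m})"

definition inv_signed :: "nat \<Rightarrow> (int \<Rightarrow> int) \<Rightarrow> nat \<Rightarrow> nat" where
  "inv_signed n \<pi> i =
     (let m = n + 1 - i; \<sigma> = underlying_perm \<pi> in
      if sign_exp \<pi> m = 0 then inv_perm n \<sigma> i
      else 1 + 2 * card {j \<in> {1..<m}. \<sigma> j < \<sigma> m} + inv_perm n \<sigma> i)"

definition inv_B :: "nat \<Rightarrow> (int \<Rightarrow> int) \<Rightarrow> nat" where
  "inv_B n \<pi> = (\<Sum>i = 1..n. inv_signed n \<pi> i)"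

definition I_B :: "nat \<Rightarrow> int \<Rightarrow> (int \<Rightarrow> int) set" where
  "I_B n k = {\<pi> \<in> hyperoctahedral n. int (inv_B n \<pi>) = k}"

definition omega :: "nat \<Rightarrow> (int \<Rightarrow> int) \<Rightarrow> nat" where
  "omega n \<pi> = (\<Sum>i = 1..n. (n - i + 1) * inv_signed n \<pi> i)"

(* The indeterminate q is the polynomial variable, so q^d is monom 1 d. The convention that the
   value is 0 unless 0 <= k <= n^2 holds automatically, see q_mahonian_B_eq_0 below. *)
definition q_mahonian_B :: "nat \<Rightarrow> int \<Rightarrow> int poly" where
  "q_mahonian_B n k = (\<Sum>\<pi>\<in>I_B n k. monom 1 (omega n \<pi>))"

(* A finite sequence is regarded as extended by 0 to all integer indices. *)
definition strongly_q_log_concave :: "(int \<Rightarrow> int poly) \<Rightarrow> bool" where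
  "strongly_q_log_concave f \<longleftrightarrow>
     (\<forall>l k. 0 < l \<and> l \<le> k \<longrightarrow> (\<forall>d. coeff (f l * f k - f (l - 1) * f (k + 1)) d \<ge> 0))"

lemma finite_hyperoctahedral: "finite (hyperoctahedral n)"
  unfolding hyperoctahedral_def
  by (rule finite_subset[OF _ finite_permutations[of "{- int n..int n} - {0}"]]) auto

lemma signed_decomposition:
  "\<pi> (int p) = (- 1) ^ sign_exp \<pi> p * int (underlying_perm \<pi> p)"
  by (simp add: sign_exp_def underlying_perm_def)

lemma underlying_perm_bij:
  assumes "\<pi> \<in> hyperoctahedral n"
  shows "bij_betw (underlying_perm \<pi>) {1..n} {1..n}"
proof -
  let ?S = "{- int n..int n} - {0}"
  have perm: "\<pi> permutes ?S" and odd: "\<And>j. j \<in> {1..int n} \<Longrightarrow> \<pi> (- j) = - \<pi> j"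
    using assms by (auto simp: hyperoctahedral_def)
  have inj: "inj \<pi>" using perm by (rule permutes_inj)
  have "underlying_perm \<pi> p \<in> {1..n}" if "p \<in> {1..n}" for p
  proof -
    have "\<pi> (int p) \<in> ?S" using permutes_in_image[OF perm, of "int p"] that by auto
    thus ?thesis by (auto simp: underlying_perm_def)
  qed
  hence sub: "underlying_perm \<pi> ` {1..n} \<subseteq> {1..n}" by blast
  have "inj_on (underlying_perm \<pi>) {1..n}"
  proof (rule inj_onI)
    fix p p' assume p: "p \<in> {1..n}" and p': "p' \<in> {1..n}"
      and eq: "underlying_perm \<pi> p = underlying_perm \<pi> p'"
    from eq have "\<pi> (int p) = \<pi> (int p') \<or> \<pi> (int p) = - \<pi> (int p')"
      by (auto simp: underlying_perm_def)
    moreover have "- \<pi> (int p') = \<pi> (- int p')" using odd[of "int p'"] p' by auto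
    ultimately have "int p = int p' \<or> int p = - int p'" using inj by (metis injD)
    thus "p = p'" using p p' by auto
  qed
  with sub show ?thesis by (simp add: bij_betw_def endo_inj_surj)
qed

lemma inv_signed_le:
  assumes "i \<in> {1..n}"
  shows "inv_signed n \<pi> i \<le> 2 * (n - i) + 1"
proof -
  define m \<sigma> where "m = n + 1 - i" and "\<sigma> = underlying_perm \<pi>"
  let ?A = "{j \<in> {1..<m}. \<sigma> j < \<sigma> m}" and ?B = "{j \<in> {1..<m}. \<sigma> j > \<sigma> m}"
  have "card ?A + card ?B = card (?A \<union> ?B)" by (subst card_Un_disjoint) auto
  also have "\<dots> \<le> card {1..<m}" by (rule card_mono) auto
  finally have "card ?A + card ?B \<le> n - i" using assms by (simp add: m_def)
  moreover have "inv_signed n \<pi> i = (if sign_exp \<pi> m = 0 then card ?B else 1 + 2 * card ?A + card ?B)"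
    by (simp only: inv_signed_def inv_perm_def Let_def m_def \<sigma>_def)
  ultimately show ?thesis by (simp split: if_splits)
qed

lemma inv_B_le: "inv_B n \<pi> \<le> n\<^sup>2"
proof -
  have "inv_B n \<pi> \<le> (\<Sum>i = 1..n. 2 * (n - i) + 1)"
    unfolding inv_B_def by (rule sum_mono) (rule inv_signed_le)
  also have "\<dots> = (\<Sum>i<n. 2 * i + 1)"
    by (rule sum.reindex_bij_witness[of _ "\<lambda>i. n - i" "\<lambda>i. n - i"]) auto
  also have "\<dots> = n\<^sup>2" by (induction n) (auto simp: power2_eq_square)
  finally show ?thesis .
qed

lemma q_mahonian_B_eq_0:
  assumes "k < 0 \<or> k > int (n\<^sup>2)"
  shows "q_mahonian_B n k = 0"
proof -
  have "int (inv_B n \<pi>) \<noteq> k" for \<pi>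
    using assms inv_B_le[of n \<pi>] by linarith
  hence "I_B n k = {}" by (simp add: I_B_def)
  thus ?thesis by (simp add: q_mahonian_B_def)
qed

end

theory Submission
  imports Defs
begin

text \<open>
  For a signed permutation \<open>\<pi>\<close> of size \<open>n\<close>, index the numbers \<open>inv_i(\<pi>)\<close> by the position
  \<open>m = n + 1 - i\<close> instead of by \<open>i\<close>, and call the result \<open>e_m\<close>. The table \<open>(e_1, \<dots>, e_n)\<close> takes
  every value in \<open>\<Prod>m. {0, \<dots>, 2 m - 1}\<close> exactly once, and the two statistics are
  \<open>inv_B = \<Sum>m. e_m\<close> and \<open>\<omega> = \<Sum>m. m * e_m\<close>. Hence

    \<open>(\<Sum>k. i_B_q(n,k) z^k) = (\<Prod>m = 1..n. 1 + q^m z + (q^m z)^2 + \<dots> + (q^m z)^(2 m - 1))\<close>.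

  Each factor is a truncated geometric series in \<open>z\<close>, and for such a sequence the products
  \<open>a_l a_k\<close> and \<open>a_(l-1) a_(k+1)\<close> are either equal or the second one vanishes. So the factors are
  strongly \<open>q\<close>-log-concave, and it remains to see that this survives multiplication.

  For that, read strong \<open>q\<close>-log-concavity as a statement on the Toeplitz matrix \<open>(a_(j-i))\<close>: all its
  \<open>2 \<times> 2\<close> minors have nonnegative coefficients (\<open>q_TP2\<close>). Convolution of sequences is
  multiplication of Toeplitz matrices, and the Cauchy--Binet formula writes a minor of a product as a
  sum of products of minors of the factors (\<open>q_TP2_convolution\<close>).

  The product formula is used in the form of a recursion on \<open>n\<close> (\<open>q_mahonian_B_Suc\<close>). A
  signed permutation of size \<open>n + 1\<close> is determined by its last value \<open>w\<close> and by the signed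
  permutation of size \<open>n\<close> obtained from the other values by closing the gap that \<open>\<bar>w\<bar>\<close> leaves among
  the absolute values. Closing the gap preserves signs and the order of absolute values, hence the
  entries \<open>e_1, \<dots>, e_n\<close>, while \<open>e_(n+1)\<close> is a bijective function of \<open>w\<close>.
\<close>

section \<open>Polynomials with nonnegative coefficients\<close>

definition nonneg_coeffs :: "int poly \<Rightarrow> bool" where
  "nonneg_coeffs p \<longleftrightarrow> (\<forall>d. coeff p d \<ge> 0)"

lemma nonneg_coeffs_0: "nonneg_coeffs 0"
  by (simp add: nonneg_coeffs_def)

lemma nonneg_coeffs_monom: "c \<ge> 0 \<Longrightarrow> nonneg_coeffs (monom c d)"
  by (simp add: nonneg_coeffs_def)

lemma nonneg_coeffs_mult: "nonneg_coeffs p \<Longrightarrow> nonneg_coeffs r \<Longrightarrow> nonneg_coeffs (p * r)"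
  by (auto simp: nonneg_coeffs_def coeff_mult intro!: sum_nonneg)

lemma nonneg_coeffs_sum: "(\<And>x. x \<in> A \<Longrightarrow> nonneg_coeffs (f x)) \<Longrightarrow> nonneg_coeffs (sum f A)"
  by (auto simp: nonneg_coeffs_def coeff_sum intro!: sum_nonneg)

section \<open>Toeplitz matrices with nonnegative minors of order two\<close>

text \<open>The expression is the minor of the matrix \<open>(f (j - i))\<close> in rows \<open>i, i'\<close> and columns \<open>j, j'\<close>.\<close>

definition q_TP2 :: "(int \<Rightarrow> int poly) \<Rightarrow> bool" where
  "q_TP2 f \<longleftrightarrow> (\<forall>i i' j j'. i \<le> i' \<longrightarrow> j \<le> j' \<longrightarrow>
     nonneg_coeffs (f (j - i) * f (j' - i') - f (j' - i) * f (j - i')))"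

text \<open>The inequality for \<open>l \<le> k\<close> is the minor in rows \<open>0, 1\<close> and columns \<open>l, k + 1\<close>.\<close>

lemma q_TP2_imp_strongly_q_log_concave:
  assumes "q_TP2 f"
  shows "strongly_q_log_concave f"
  unfolding strongly_q_log_concave_def
proof (intro allI impI)
  fix l k :: int and d
  assume "0 < l \<and> l \<le> k"
  hence "nonneg_coeffs (f (l - 0) * f (k + 1 - 1) - f (k + 1 - 0) * f (l - 1))"
    using assms unfolding q_TP2_def by (meson zero_le_one zle_add1_eq_le order_less_imp_le)
  thus "0 \<le> coeff (f l * f k - f (l - 1) * f (k + 1)) d"
    by (simp add: nonneg_coeffs_def mult.commute)
qed

text \<open>
  Coefficients of \<open>z^k\<close> in \<open>1 + q^m z + \<dots> + (q^m z)^(N-1)\<close>.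
\<close>

definition truncated_geometric :: "nat \<Rightarrow> nat \<Rightarrow> int \<Rightarrow> int poly" where
  "truncated_geometric m N k = (if 0 \<le> k \<and> k < int N then monom 1 (m * nat k) else 0)"

text \<open>
  The two products in a minor have the same index sum, and the indices of the subtracted one enclose
  those of the other. So if the subtracted product is nonzero, then the other one is nonzero as
  well and they are the same power of \<open>q\<close>.
\<close>

lemma q_TP2_truncated_geometric: "q_TP2 (truncated_geometric m N)"
  unfolding q_TP2_def
proof (intro allI impI)
  fix i i' j j' :: int
  assume le: "i \<le> i'" "j \<le> j'"
  let ?g = "truncated_geometric m N"
  show "nonneg_coeffs (?g (j - i) * ?g (j' - i') - ?g (j' - i) * ?g (j - i'))"
  proof (cases "0 \<le> j - i' \<and> j' - i < int N")
    case True
    have "nat (j - i) + nat (j' - i') = nat (j' - i) + nat (j - i')"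
      using True le by linarith
    hence "m * nat (j - i) + m * nat (j' - i') = m * nat (j' - i) + m * nat (j - i')"
      by (metis distrib_left)
    hence "?g (j - i) * ?g (j' - i') = ?g (j' - i) * ?g (j - i')"
      using True le by (simp add: truncated_geometric_def mult_monom)
    thus ?thesis by (simp add: nonneg_coeffs_0)
  next
    case False
    hence "?g (j' - i) * ?g (j - i') = 0"
      using le by (auto simp: truncated_geometric_def)
    moreover have "nonneg_coeffs (?g x)" for x
      by (simp add: truncated_geometric_def nonneg_coeffs_0 nonneg_coeffs_monom)
    ultimately show ?thesis by (simp only: diff_0_right nonneg_coeffs_mult)
  qed
qed

text \<open>
  Expanding both sums, the minor of the product is the sum of \<open>a t * a' t' * (b t * b' t' - b' t * b t')\<close>
  over all pairs. The bracket is antisymmetric in \<open>t, t'\<close>, so the diagonal drops out and the terms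
  of \<open>(t, t')\<close> and \<open>(t', t)\<close> combine to a product of two minors.
\<close>

lemma Cauchy_Binet_2:
  fixes a a' b b' :: "'i::linorder \<Rightarrow> 'a::comm_ring"
  assumes T: "finite T"
  shows "(\<Sum>t\<in>T. a t * b t) * (\<Sum>t\<in>T. a' t * b' t) - (\<Sum>t\<in>T. a t * b' t) * (\<Sum>t\<in>T. a' t * b t)
       = (\<Sum>(t, t')\<in>{(t, t') \<in> T \<times> T. t < t'}. (a t * a' t' - a t' * a' t) * (b t * b' t' - b' t * b t'))"
proof -
  define h where "h = (\<lambda>(t, t'). a t * a' t' * (b t * b' t' - b' t * b t'))"
  let ?L = "{(t, t') \<in> T \<times> T. t < t'}" and ?G = "{(t, t') \<in> T \<times> T. t' < t}"
    and ?E = "{(t, t') \<in> T \<times> T. t = t'}"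
  have fin: "finite ?L" "finite ?G" "finite ?E"
    by (rule finite_subset[of _ "T \<times> T"]; use T in auto)+
  have "(\<Sum>t\<in>T. a t * b t) * (\<Sum>t\<in>T. a' t * b' t) - (\<Sum>t\<in>T. a t * b' t) * (\<Sum>t\<in>T. a' t * b t)
      = sum h (T \<times> T)"
    by (simp add: sum_product sum_subtractf[symmetric] sum.cartesian_product h_def
        algebra_simps split_def)
  also have "T \<times> T = (?L \<union> ?G) \<union> ?E"
    by auto
  also have "sum h \<dots> = sum h ?L + sum h ?G + sum h ?E"
    using fin by (subst sum.union_disjoint; (subst sum.union_disjoint)?; auto)
  also have "sum h ?E = 0"
    by (rule sum.neutral) (auto simp: h_def algebra_simps)
  also have "sum h ?G = (\<Sum>(t, t')\<in>?L. h (t', t))"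
    by (rule sum.reindex_bij_witness[of _ prod.swap prod.swap]) auto
  also have "sum h ?L + \<dots> + 0
      = (\<Sum>(t, t')\<in>?L. (a t * a' t' - a t' * a' t) * (b t * b' t' - b' t * b t'))"
    by (simp add: sum.distrib[symmetric] h_def split_def algebra_simps)
  finally show ?thesis .
qed

text \<open>
  The sequence \<open>c\<close> is the convolution of \<open>g\<close> and \<open>f\<close>. With \<open>t = i + s\<close> it reads
  \<open>c (j - i) = (\<Sum>t. g (t - i) * f (j - t))\<close>, which is a product of Toeplitz matrices.
\<close>

lemma q_TP2_convolution:
  assumes g: "q_TP2 g" and f: "q_TP2 f"
    and supp: "\<And>s. s < 0 \<or> int N \<le> s \<Longrightarrow> g s = 0"
    and c: "\<And>k. c k = (\<Sum>s\<in>{0..<int N}. g s * f (k - s))"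
  shows "q_TP2 c"
  unfolding q_TP2_def
proof (intro allI impI)
  fix i i' j j' :: int
  assume le: "i \<le> i'" "j \<le> j'"
  \<comment> \<open>a finite range of columns that contains the supports of the rows \<open>i\<close> and \<open>i'\<close>\<close>
  define T where "T = {i..<i' + int N}"
  have conv: "c (y - x) = (\<Sum>t\<in>T. g (t - x) * f (y - t))" if "x = i \<or> x = i'" for x y
  proof -
    have "c (y - x) = (\<Sum>t\<in>{x..<x + int N}. g (t - x) * f (y - t))"
      unfolding c by (rule sum.reindex_bij_witness[of _ "\<lambda>t. t - x" "\<lambda>s. s + x"])
        (auto simp: algebra_simps)
    also have "\<dots> = (\<Sum>t\<in>T. g (t - x) * f (y - t))"
      by (rule sum.mono_neutral_left) (use that le in \<open>auto simp: T_def intro!: supp\<close>)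
    finally show ?thesis .
  qed
  have "c (j - i) * c (j' - i') - c (j' - i) * c (j - i')
      = (\<Sum>(t, t')\<in>{(t, t') \<in> T \<times> T. t < t'}.
          (g (t - i) * g (t' - i') - g (t' - i) * g (t - i'))
          * (f (j - t) * f (j' - t') - f (j' - t) * f (j - t')))"
    by (simp only: conv simp_thms) (rule Cauchy_Binet_2, simp add: T_def)
  moreover have "nonneg_coeffs \<dots>"
    using f g le by (auto simp: q_TP2_def intro!: nonneg_coeffs_sum nonneg_coeffs_mult)
  ultimately show "nonneg_coeffs (c (j - i) * c (j' - i') - c (j' - i) * c (j - i'))"
    by simp
qed

section \<open>Inversion tables of signed permutations\<close>

abbreviation signed_range :: "nat \<Rightarrow> int set" where
  "signed_range n \<equiv> {- int n..int n} - {0}"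

text \<open>
  Points outside of \<open>signed_range n\<close> are fixed, so oddness holds on all integers. In this form it
  passes to compositions and inverses.
\<close>

lemma hyperoctahedral_iff:
  "\<pi> \<in> hyperoctahedral n \<longleftrightarrow> \<pi> permutes signed_range n \<and> (\<forall>j. \<pi> (- j) = - \<pi> j)"
proof -
  have "\<pi> (- j) = - \<pi> j"
    if perm: "\<pi> permutes signed_range n" and odd: "\<forall>j\<in>{1..int n}. \<pi> (- j) = - \<pi> j" for j
  proof -
    consider "j \<in> {1..int n}" | "- j \<in> {1..int n}" | "j \<notin> signed_range n" "- j \<notin> signed_range n"
      by fastforce
    thus ?thesis
    proof cases
      case 2
      hence "\<pi> (- (- j)) = - \<pi> (- j)" using odd by blast
      thus ?thesis by simp
    next
      case 3
      thus ?thesis using permutes_not_in[OF perm] by metis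
    qed (use odd in blast)
  qed
  thus ?thesis by (auto simp: hyperoctahedral_def)
qed

text \<open>
  The number \<open>inv_i\<close> at the position \<open>m = n + 1 - i\<close>. It depends on \<open>\<pi> 1, \<dots>, \<pi> m\<close> only, not on
  \<open>n\<close>.
\<close>

definition table_entry :: "(int \<Rightarrow> int) \<Rightarrow> nat \<Rightarrow> nat" where
  "table_entry \<pi> m =
     (if \<pi> (int m) < 0 then 1 + 2 * card {j \<in> {1..<m}. \<bar>\<pi> (int j)\<bar> < \<bar>\<pi> (int m)\<bar>} else 0)
     + card {j \<in> {1..<m}. \<bar>\<pi> (int m)\<bar> < \<bar>\<pi> (int j)\<bar>}"

lemma inv_signed_eq_table_entry: "inv_signed n \<pi> i = table_entry \<pi> (n + 1 - i)"
proof -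
  have "nat \<bar>x\<bar> < nat \<bar>y\<bar> \<longleftrightarrow> \<bar>x\<bar> < \<bar>y\<bar>" for x y :: int by linarith
  thus ?thesis
    by (simp add: inv_signed_def inv_perm_def table_entry_def sign_exp_def underlying_perm_def Let_def)
qed

lemma inv_B_eq: "inv_B n \<pi> = (\<Sum>m = 1..n. table_entry \<pi> m)"
  unfolding inv_B_def inv_signed_eq_table_entry
  by (rule sum.reindex_bij_witness[of _ "\<lambda>m. n + 1 - m" "\<lambda>i. n + 1 - i"]) auto

lemma omega_eq: "omega n \<pi> = (\<Sum>m = 1..n. m * table_entry \<pi> m)"
  unfolding omega_def inv_signed_eq_table_entry
  by (rule sum.reindex_bij_witness[of _ "\<lambda>m. n + 1 - m" "\<lambda>i. n + 1 - i"])
    (auto simp: Suc_diff_le)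

text \<open>
  The table entry at the last position of a signed permutation with last value \<open>w\<close>: all absolute
  values occur, so \<open>n - \<bar>w\<bar>\<close> of them are larger than \<open>\<bar>w\<bar>\<close> and \<open>\<bar>w\<bar> - 1\<close> are smaller.
\<close>

definition last_entry :: "nat \<Rightarrow> int \<Rightarrow> nat" where
  "last_entry n w = nat (if w < 0 then int n - 1 - w else int n - w)"

lemma table_entry_last:
  assumes \<pi>: "\<pi> \<in> hyperoctahedral n" and n: "n \<ge> 1"
  shows "table_entry \<pi> n = last_entry n (\<pi> (int n))"
proof -
  define \<sigma> where "\<sigma> = underlying_perm \<pi>"
  have bij: "bij_betw \<sigma> {1..n} {1..n}"
    using underlying_perm_bij[OF \<pi>] by (simp add: \<sigma>_def)
  have card_eq: "card {j \<in> {1..n}. P (\<sigma> j)} = card {v \<in> {1..n}. P v}" for P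
  proof (rule bij_betw_same_card)
    have "\<sigma> ` {j \<in> {1..n}. P (\<sigma> j)} = {v \<in> \<sigma> ` {1..n}. P v}" by blast
    also have "\<sigma> ` {1..n} = {1..n}" using bij by (rule bij_betw_imp_surj_on)
    finally show "bij_betw \<sigma> {j \<in> {1..n}. P (\<sigma> j)} {v \<in> {1..n}. P v}"
      by (intro bij_betw_subset[OF bij]) auto
  qed
  have \<sigma>n: "\<sigma> n \<in> {1..n}" using bij n by (auto simp: bij_betw_def)
  have lt: "\<bar>\<pi> (int i)\<bar> < \<bar>\<pi> (int j)\<bar> \<longleftrightarrow> \<sigma> i < \<sigma> j" for i j
    by (auto simp: \<sigma>_def underlying_perm_def)
  have "{j \<in> {1..<n}. \<sigma> j < \<sigma> n} = {j \<in> {1..n}. \<sigma> j < \<sigma> n}"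
    by (auto simp: less_le)
  also have "card \<dots> = card {v \<in> {1..n}. v < \<sigma> n}" by (rule card_eq)
  also have "{v \<in> {1..n}. v < \<sigma> n} = {1..<\<sigma> n}" using \<sigma>n by auto
  finally have less: "card {j \<in> {1..<n}. \<sigma> j < \<sigma> n} = \<sigma> n - 1" by simp
  have "{j \<in> {1..<n}. \<sigma> n < \<sigma> j} = {j \<in> {1..n}. \<sigma> n < \<sigma> j}"
    by (auto simp: less_le)
  also have "card \<dots> = card {v \<in> {1..n}. \<sigma> n < v}" by (rule card_eq)
  also have "{v \<in> {1..n}. \<sigma> n < v} = {\<sigma> n<..n}" using \<sigma>n by auto
  finally have greater: "card {j \<in> {1..<n}. \<sigma> n < \<sigma> j} = n - \<sigma> n" by simp
  show ?thesis
    unfolding table_entry_def lt less greater last_entry_def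
    using \<sigma>n by (auto simp: \<sigma>_def underlying_perm_def)
qed

lemma bij_betw_last_entry: "bij_betw (last_entry n) (signed_range n) {..<2 * n}"
  by (rule bij_betw_byWitness[where
        f' = "\<lambda>t. if t < n then int n - int t else int n - 1 - int t"])
    (auto simp: last_entry_def split: if_splits)

section \<open>Removing the last value\<close>

text \<open>
  The odd map that opens a gap at \<open>\<bar>w\<bar>\<close> among the absolute values below \<open>n\<close>, and puts \<open>w\<close> as image
  of \<open>n\<close>.
\<close>

definition open_gap :: "nat \<Rightarrow> int \<Rightarrow> int \<Rightarrow> int" where
  "open_gap n w x =
     (if \<bar>x\<bar> > int n then x
      else if \<bar>x\<bar> = int n then sgn x * w
      else if \<bar>x\<bar> < \<bar>w\<bar> then x else x + sgn x)"

lemma open_gap_hyperoctahedral: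
  assumes w: "w \<in> signed_range n"
  shows "open_gap n w \<in> hyperoctahedral n"
proof -
  have "inj_on (open_gap n w) (signed_range n)"
    using w by (auto simp: inj_on_def open_gap_def sgn_if abs_if split: if_splits)
  moreover have "open_gap n w ` signed_range n \<subseteq> signed_range n"
    using w by (auto simp: open_gap_def sgn_if abs_if)
  ultimately have "bij_betw (open_gap n w) (signed_range n) (signed_range n)"
    by (simp add: bij_betw_def endo_inj_surj)
  hence "open_gap n w permutes signed_range n"
    by (rule bij_imp_permutes) (use w in \<open>auto simp: open_gap_def sgn_if\<close>)
  thus ?thesis
    by (auto simp: hyperoctahedral_iff open_gap_def sgn_if)
qed

lemma open_gap_last: "n \<ge> 1 \<Longrightarrow> open_gap n w (int n) = w"
  by (simp add: open_gap_def)

lemma open_gap_less_iff: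
  assumes "x \<in> signed_range n" "y \<in> signed_range n"
  shows "\<bar>open_gap (Suc n) w x\<bar> < \<bar>open_gap (Suc n) w y\<bar> \<longleftrightarrow> \<bar>x\<bar> < \<bar>y\<bar>"
    and "open_gap (Suc n) w x < 0 \<longleftrightarrow> x < 0"
  using assms by (auto simp: open_gap_def sgn_if abs_if)

lemma hyperoctahedral_comp:
  "\<pi> \<in> hyperoctahedral n \<Longrightarrow> \<rho> \<in> hyperoctahedral n \<Longrightarrow> \<pi> \<circ> \<rho> \<in> hyperoctahedral n"
  by (auto simp: hyperoctahedral_iff intro: permutes_compose)

lemma hyperoctahedral_inv:
  assumes "\<pi> \<in> hyperoctahedral n"
  shows "inv \<pi> \<in> hyperoctahedral n"
proof -
  have perm: "\<pi> permutes signed_range n" and odd: "\<pi> (- j) = - \<pi> j" for j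
    using assms by (auto simp: hyperoctahedral_iff)
  have "inv \<pi> (- j) = - inv \<pi> j" for j
    by (metis odd permutes_inverses[OF perm])
  thus ?thesis
    using permutes_inv[OF perm] by (simp add: hyperoctahedral_iff)
qed

text \<open>
  Since a signed permutation acts on all integers, no conversion is needed to regard one of size \<open>n\<close>
  as one of size \<open>n + 1\<close>, which can then be composed with \<open>open_gap\<close>.
\<close>

lemma hyperoctahedral_Suc_fixing:
  "\<pi> \<in> hyperoctahedral n \<longleftrightarrow> \<pi> \<in> hyperoctahedral (Suc n) \<and> \<pi> (int (Suc n)) = int (Suc n)"
proof
  assume "\<pi> \<in> hyperoctahedral n"
  thus "\<pi> \<in> hyperoctahedral (Suc n) \<and> \<pi> (int (Suc n)) = int (Suc n)"
    by (auto simp: hyperoctahedral_iff intro: permutes_subset elim: permutes_not_in)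
next
  assume R: "\<pi> \<in> hyperoctahedral (Suc n) \<and> \<pi> (int (Suc n)) = int (Suc n)"
  hence fix_minus: "\<pi> (- int (Suc n)) = - int (Suc n)"
    by (simp add: hyperoctahedral_iff del: of_nat_Suc)
  have "\<pi> permutes signed_range n"
  proof (rule permutes_superset)
    show "\<pi> permutes signed_range (Suc n)" using R by (simp add: hyperoctahedral_iff)
    fix x assume "x \<in> signed_range (Suc n) - signed_range n"
    hence "x = int (Suc n) \<or> x = - int (Suc n)" by auto
    thus "\<pi> x = x" using R fix_minus by metis
  qed
  thus "\<pi> \<in> hyperoctahedral n" using R by (simp add: hyperoctahedral_iff)
qed

text \<open>
  The pair \<open>(w, \<rho>)\<close> is recovered from the composition \<open>\<pi>\<close>: as \<open>\<rho>\<close> fixes \<open>n + 1\<close>, the value of \<open>\<pi>\<close>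
  there is \<open>w\<close>, and \<open>\<rho>\<close> is what remains after undoing the gap. Conversely, for every \<open>\<pi>\<close> of size
  \<open>n + 1\<close>, closing the gap at its last value sends that value to \<open>n + 1\<close>, so the result fixes \<open>n + 1\<close>.
\<close>

lemma bij_betw_open_gap_comp:
  "bij_betw (\<lambda>(w, \<rho>). open_gap (Suc n) w \<circ> \<rho>)
     (signed_range (Suc n) \<times> hyperoctahedral n) (hyperoctahedral (Suc n))"
proof (rule bij_betw_byWitness[where
      f' = "\<lambda>\<pi>. (\<pi> (int (Suc n)), inv (open_gap (Suc n) (\<pi> (int (Suc n)))) \<circ> \<pi>)"])
  let ?N = "int (Suc n)"
  have perm: "open_gap (Suc n) w permutes signed_range (Suc n)" if "w \<in> signed_range (Suc n)" for w
    using open_gap_hyperoctahedral[OF that] by (simp add: hyperoctahedral_iff)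
  have last: "\<pi> ?N \<in> signed_range (Suc n)" if "\<pi> \<in> hyperoctahedral (Suc n)" for \<pi>
    using that permutes_in_image[of \<pi> "signed_range (Suc n)" ?N]
    by (auto simp: hyperoctahedral_iff)
  show "\<forall>x\<in>signed_range (Suc n) \<times> hyperoctahedral n.
      (\<lambda>\<pi>. (\<pi> ?N, inv (open_gap (Suc n) (\<pi> ?N)) \<circ> \<pi>))
        ((\<lambda>(w, \<rho>). open_gap (Suc n) w \<circ> \<rho>) x) = x"
  proof (rule ballI)
    fix x assume "x \<in> signed_range (Suc n) \<times> hyperoctahedral n"
    then obtain w \<rho> where x: "x = (w, \<rho>)"
      and w: "w \<in> signed_range (Suc n)" and \<rho>: "\<rho> \<in> hyperoctahedral n"
      by (rule SigmaE)
    have "\<rho> ?N = ?N" using \<rho> hyperoctahedral_Suc_fixing by blast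
    hence val: "(open_gap (Suc n) w \<circ> \<rho>) ?N = w"
      using open_gap_last[of "Suc n" w] by (simp del: of_nat_Suc)
    have "inv (open_gap (Suc n) w) \<circ> (open_gap (Suc n) w \<circ> \<rho>) = \<rho>"
      using permutes_inv_o(2)[OF perm[OF w]] by (simp add: o_assoc)
    thus "(\<lambda>\<pi>. (\<pi> ?N, inv (open_gap (Suc n) (\<pi> ?N)) \<circ> \<pi>))
        ((\<lambda>(w, \<rho>). open_gap (Suc n) w \<circ> \<rho>) x) = x"
      by (simp only: x val split)
  qed
  show "\<forall>\<pi>\<in>hyperoctahedral (Suc n). (\<lambda>(w, \<rho>). open_gap (Suc n) w \<circ> \<rho>)
      (\<pi> ?N, inv (open_gap (Suc n) (\<pi> ?N)) \<circ> \<pi>) = \<pi>"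
    using permutes_inv_o(1)[OF perm[OF last]] by (simp add: o_assoc del: of_nat_Suc)
  show "(\<lambda>(w, \<rho>). open_gap (Suc n) w \<circ> \<rho>) ` (signed_range (Suc n) \<times> hyperoctahedral n)
      \<subseteq> hyperoctahedral (Suc n)"
  proof (rule image_subsetI)
    fix x assume "x \<in> signed_range (Suc n) \<times> hyperoctahedral n"
    then obtain w \<rho> where x: "x = (w, \<rho>)"
      and w: "w \<in> signed_range (Suc n)" and \<rho>: "\<rho> \<in> hyperoctahedral n"
      by (rule SigmaE)
    have "\<rho> \<in> hyperoctahedral (Suc n)" using \<rho> hyperoctahedral_Suc_fixing by blast
    hence "open_gap (Suc n) w \<circ> \<rho> \<in> hyperoctahedral (Suc n)"
      by (intro hyperoctahedral_comp open_gap_hyperoctahedral w)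
    thus "(\<lambda>(w, \<rho>). open_gap (Suc n) w \<circ> \<rho>) x \<in> hyperoctahedral (Suc n)"
      by (simp only: x split)
  qed
  show "(\<lambda>\<pi>. (\<pi> ?N, inv (open_gap (Suc n) (\<pi> ?N)) \<circ> \<pi>)) ` hyperoctahedral (Suc n)
      \<subseteq> signed_range (Suc n) \<times> hyperoctahedral n"
  proof (rule image_subsetI)
    fix \<pi> assume \<pi>: "\<pi> \<in> hyperoctahedral (Suc n)"
    let ?c = "open_gap (Suc n) (\<pi> ?N)"
    have "inv ?c \<circ> \<pi> \<in> hyperoctahedral (Suc n)"
      by (intro hyperoctahedral_comp hyperoctahedral_inv open_gap_hyperoctahedral last \<pi>)
    moreover have "(inv ?c \<circ> \<pi>) ?N = ?N"
      using open_gap_last[of "Suc n" "\<pi> ?N"] permutes_inverses(2)[OF perm[OF last[OF \<pi>]], of ?N]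
      by (simp del: of_nat_Suc)
    ultimately have "inv ?c \<circ> \<pi> \<in> hyperoctahedral n"
      using hyperoctahedral_Suc_fixing by blast
    thus "(\<pi> ?N, inv ?c \<circ> \<pi>) \<in> signed_range (Suc n) \<times> hyperoctahedral n"
      using last[OF \<pi>] by blast
  qed
qed

text \<open>Table entries only see signs and the order of absolute values, and \<open>open_gap\<close> preserves both.\<close>

lemma table_entry_open_gap_comp:
  assumes \<rho>: "\<rho> \<in> hyperoctahedral n" and m: "m \<in> {1..n}"
  shows "table_entry (open_gap (Suc n) w \<circ> \<rho>) m = table_entry \<rho> m"
proof -
  have mem: "\<rho> (int j) \<in> signed_range n" if "j \<in> {1..n}" for j
    using \<rho> that permutes_in_image[of \<rho> "signed_range n" "int j"]
    by (auto simp: hyperoctahedral_iff)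
  have "{j \<in> {1..<m}. \<bar>open_gap (Suc n) w (\<rho> (int j))\<bar> < \<bar>open_gap (Suc n) w (\<rho> (int m))\<bar>}
      = {j \<in> {1..<m}. \<bar>\<rho> (int j)\<bar> < \<bar>\<rho> (int m)\<bar>}"
    "{j \<in> {1..<m}. \<bar>open_gap (Suc n) w (\<rho> (int m))\<bar> < \<bar>open_gap (Suc n) w (\<rho> (int j))\<bar>}
      = {j \<in> {1..<m}. \<bar>\<rho> (int m)\<bar> < \<bar>\<rho> (int j)\<bar>}"
    using m by (intro Collect_cong conj_cong refl open_gap_less_iff(1) mem; simp)+
  moreover have "open_gap (Suc n) w (\<rho> (int m)) < 0 \<longleftrightarrow> \<rho> (int m) < 0"
    by (rule open_gap_less_iff(2)[OF mem mem]) (use m in auto)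
  ultimately show ?thesis by (simp only: table_entry_def o_apply)
qed

section \<open>The recursion for the Mahonian polynomials\<close>

lemma q_mahonian_B_eq_sum:
  "q_mahonian_B n k =
     (\<Sum>\<pi>\<in>hyperoctahedral n. if int (inv_B n \<pi>) = k then monom 1 (omega n \<pi>) else 0)"
  unfolding q_mahonian_B_def I_B_def
  by (rule sum.inter_filter) (rule finite_hyperoctahedral)

text \<open>
  In the decomposition of a signed permutation of size \<open>n + 1\<close> by its last value \<open>w\<close>, the last table
  entry \<open>s\<close> ranges over \<open>0, \<dots>, 2 n + 1\<close>. It adds \<open>s\<close> to \<open>inv_B\<close> and \<open>(n + 1) * s\<close> to \<open>\<omega>\<close>, which
  is multiplication by \<open>(q^(n+1) z)^s\<close>.
\<close>

lemma q_mahonian_B_Suc: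
  "q_mahonian_B (Suc n) k =
     (\<Sum>s\<in>{0..<int (2 * Suc n)}. truncated_geometric (Suc n) (2 * Suc n) s * q_mahonian_B n (k - s))"
proof -
  let ?N = "Suc n"
  have last: "table_entry (open_gap ?N w \<circ> \<rho>) ?N = last_entry ?N w"
    if w: "w \<in> signed_range ?N" and \<rho>: "\<rho> \<in> hyperoctahedral n" for w \<rho>
  proof -
    have \<rho>': "\<rho> \<in> hyperoctahedral ?N" "\<rho> (int ?N) = int ?N"
      using \<rho> hyperoctahedral_Suc_fixing by blast+
    have "open_gap ?N w \<circ> \<rho> \<in> hyperoctahedral ?N"
      by (intro hyperoctahedral_comp open_gap_hyperoctahedral w \<rho>'(1))
    moreover have "(open_gap ?N w \<circ> \<rho>) (int ?N) = w"
      using \<rho>'(2) open_gap_last[of ?N w] by (simp del: of_nat_Suc)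
    ultimately show ?thesis
      by (metis table_entry_last le_add1 plus_1_eq_Suc)
  qed
  have inv_B: "inv_B ?N (open_gap ?N w \<circ> \<rho>) = inv_B n \<rho> + last_entry ?N w"
    and omega: "omega ?N (open_gap ?N w \<circ> \<rho>) = omega n \<rho> + ?N * last_entry ?N w"
    if "w \<in> signed_range ?N" "\<rho> \<in> hyperoctahedral n" for w \<rho>
    using last[OF that] table_entry_open_gap_comp[OF that(2), of _ w]
    by (simp_all add: inv_B_eq omega_eq)
  have "q_mahonian_B ?N k = (\<Sum>(w, \<rho>)\<in>signed_range ?N \<times> hyperoctahedral n.
      if int (inv_B n \<rho> + last_entry ?N w) = k
      then monom 1 (omega n \<rho> + ?N * last_entry ?N w) else 0)"
    unfolding q_mahonian_B_eq_sum sum.reindex_bij_betw[OF bij_betw_open_gap_comp, symmetric]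
    by (intro sum.cong refl) (clarsimp simp only: inv_B omega mem_Times_iff split_def)
  also have "\<dots> = (\<Sum>w\<in>signed_range ?N. \<Sum>\<rho>\<in>hyperoctahedral n.
      if int (inv_B n \<rho> + last_entry ?N w) = k
      then monom 1 (omega n \<rho> + ?N * last_entry ?N w) else 0)"
    by (rule sum.cartesian_product[symmetric])
  also have "\<dots> = (\<Sum>t\<in>{..<2 * ?N}. \<Sum>\<rho>\<in>hyperoctahedral n.
      if int (inv_B n \<rho> + t) = k then monom 1 (omega n \<rho> + ?N * t) else 0)"
    by (rule sum.reindex_bij_betw[OF bij_betw_last_entry])
  also have "\<dots> = (\<Sum>t\<in>{..<2 * ?N}. monom 1 (?N * t) * q_mahonian_B n (k - int t))"
    unfolding q_mahonian_B_eq_sum sum_distrib_left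
    by (intro sum.cong refl) (auto simp: mult_monom add.commute)
  also have "\<dots> = (\<Sum>s\<in>{0..<int (2 * ?N)}. truncated_geometric ?N (2 * ?N) s * q_mahonian_B n (k - s))"
    by (rule sum.reindex_bij_witness[of _ nat int]) (auto simp: truncated_geometric_def)
  finally show ?thesis .
qed

lemma q_mahonian_B_0: "q_mahonian_B 0 = truncated_geometric 0 1"
proof
  fix k
  have "hyperoctahedral 0 = {id}"
    by (auto simp: hyperoctahedral_def)
  thus "q_mahonian_B 0 k = truncated_geometric 0 1 k"
    by (auto simp: q_mahonian_B_eq_sum truncated_geometric_def inv_B_def omega_def)
qed

lemma q_TP2_q_mahonian_B: "q_TP2 (q_mahonian_B n)"
proof (induction n)
  case 0
  show ?case by (simp add: q_mahonian_B_0 q_TP2_truncated_geometric)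
next
  case (Suc n)
  show ?case
    by (rule q_TP2_convolution[OF q_TP2_truncated_geometric Suc.IH _ q_mahonian_B_Suc])
      (auto simp: truncated_geometric_def)
qed

theorem theorem5p2:
  fixes n :: nat
  assumes "n \<ge> 1"
  shows "strongly_q_log_concave (q_mahonian_B n)"
  by (rule q_TP2_imp_strongly_q_log_concave[OF q_TP2_q_mahonian_B])

end
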